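(* Let $X$ be a (real or complex) Banach space, and let $\mathcal{A}$ be a norm-closed algebra of operators in $\mathcal{L}(X)$. If there exists a halfspace $Y$ of $X$ which is almost-invariant under every $A\in\mathcal{A}$, then there exists a halfspace $Z$ of $X$ which is invariant under every $A\in\mathcal{A}$ (that is, $AZ\subseteq Z$ for every $A\in\mathcal{A}$).
   Context: $\mathcal{L}(X)$ denotes the algebra of all continuous linear operators from the Banach space $X$ to itself, with the operator norm. An algebra of operators in $\mathcal{L}(X)$ is a linear subspace of $\mathcal{L}(X)$ closed under composition (not assumed to contain the identity). A halfspace of $X$ is a closed subspace of $X$ which has both infinite dimension and infinite codimension in $X$. A subspace $Y$ of $X$ is almost-invariant under $T\in\mathcal{L}(X)$ if $TY\subseteq Y+E$ for some finite-dimensional subspace $E$ of $X$ (the subspace $E$ may depend on $T$). *)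

theory Defs
  imports "HOL-Analysis.Analysis"
begin

text \<open>
  A Banach space over a scalar field, given by a scalar multiplication on a type of class
  \<open>banach\<close>. It is used below for \<open>scale = scaleR\<close> and for \<open>scale :: complex \<Rightarrow> _\<close>. Every complex Banach
  space is of the latter form, its real scalar multiplication being the restriction of the
  complex one (axiom \<open>scale_of_real\<close>).
\<close>

locale banach_space = vs: vector_space scale
  for scale :: "'k::real_normed_field \<Rightarrow> 'x::banach \<Rightarrow> 'x" +
  assumes scale_of_real: "scale (of_real r) x = r *\<^sub>R x"
    and norm_scale: "norm (scale c x) = norm c * norm x"
begin

text \<open>
  The elements of \<open>'x \<Rightarrow>\<^sub>L 'x\<close> are the bounded real-linear maps; \<open>\<L>(X)\<close> consists of those
  that are linear over the scalar field. Its operator norm is the norm of \<open>'x \<Rightarrow>\<^sub>L 'x\<close>.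
\<close>

definition operators :: "('x \<Rightarrow>\<^sub>L 'x) set"
  where "operators = {T. Vector_Spaces.linear scale scale (blinfun_apply T)}"

definition op_scale :: "'k \<Rightarrow> ('x \<Rightarrow>\<^sub>L 'x) \<Rightarrow> ('x \<Rightarrow>\<^sub>L 'x)"
  where "op_scale c T = Blinfun (\<lambda>x. scale c (T x))"

lemma bounded_linear_scale: "bounded_linear (scale c)"
proof (rule bounded_linear_intro[where K = "norm c"])
  fix r x
  have "scale c (scale (of_real r) x) = scale (of_real r) (scale c x)"
    by (simp only: vs.scale_scale mult.commute)
  then show "scale c (r *\<^sub>R x) = r *\<^sub>R scale c x"
    by (simp only: scale_of_real)
qed (simp_all add: vs.scale_right_distrib norm_scale mult.commute)

lemma op_scale_apply [simp]: "op_scale c T x = scale c (T x)"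
  unfolding op_scale_def
  by (subst bounded_linear_Blinfun_apply)
    (auto intro: bounded_linear_compose[OF bounded_linear_scale blinfun.bounded_linear_right])

sublocale op: vector_space op_scale
  by unfold_locales
    (auto intro!: blinfun_eqI
      simp: blinfun.add_left vs.scale_right_distrib vs.scale_left_distrib)

definition closed_algebra :: "('x \<Rightarrow>\<^sub>L 'x) set \<Rightarrow> bool"
  where "closed_algebra \<A> \<longleftrightarrow>
    \<A> \<subseteq> operators \<and> op.subspace \<A> \<and> (\<forall>S\<in>\<A>. \<forall>T\<in>\<A>. S o\<^sub>L T \<in> \<A>) \<and> closed \<A>"

definition finite_dimensional :: "'x set \<Rightarrow> bool"
  where "finite_dimensional E \<longleftrightarrow> (\<exists>B. finite B \<and> E = vs.span B)"

text \<open>The quotient by \<open>Y\<close> is spanned by the cosets of finitely many vectors.\<close>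

definition finite_codimensional :: "'x set \<Rightarrow> bool"
  where "finite_codimensional Y \<longleftrightarrow> (\<exists>B. finite B \<and> vs.span (Y \<union> B) = UNIV)"

definition halfspace :: "'x set \<Rightarrow> bool"
  where "halfspace Y \<longleftrightarrow>
    vs.subspace Y \<and> closed Y \<and> \<not> finite_dimensional Y \<and> \<not> finite_codimensional Y"

definition almost_invariant :: "('x \<Rightarrow>\<^sub>L 'x) \<Rightarrow> 'x set \<Rightarrow> bool"
  where "almost_invariant T Y \<longleftrightarrow>
    (\<exists>E. finite_dimensional E \<and> blinfun_apply T ` Y \<subseteq> {y + e | y e. y \<in> Y \<and> e \<in> E})"

end

lemma banach_space_scaleR: "banach_space (scaleR :: real \<Rightarrow> 'x::banach \<Rightarrow> 'x)"
  by unfold_locales (auto simp: scaleR_add_right scaleR_add_left)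

lemma banach_space_complex: "banach_space ((*) :: complex \<Rightarrow> complex \<Rightarrow> complex)"
  by unfold_locales (auto simp: algebra_simps norm_mult scaleR_conv_of_real)

end

theory Submission
  imports Defs
begin

text \<open>
  Each \<open>A \<in> \<A>\<close> induces a finite-rank operator \<open>Y \<rightarrow> X / Y\<close>, but a priori neither its kernel nor its
  range is controlled as \<open>A\<close> varies. The point is that both can be controlled uniformly.

  The operators whose induced rank is at least \<open>n\<close> form an open set (\<open>open_rank_ge\<close>), and no
  element of \<open>\<A>\<close> lies in all of these sets. By the Baire category theorem in the closed set \<open>\<A>\<close>, the
  rank is bounded on some nonempty relatively open part of \<open>\<A>\<close>
  (\<open>almost_invariant_locally_bounded_rank\<close>). Let \<open>S\<close> be an operator in this part whose rank \<open>m\<close> is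
  the largest occurring there, and let \<open>y\<^sub>1, \<dots>, y\<^sub>m \<in> Y\<close> have images \<open>S y\<^sub>i\<close> that are
  independent modulo \<open>Y\<close>. If \<open>T \<in> \<A>\<close> took a vector \<open>w\<close> of the induced kernel
  \<open>Y\<^sub>0 = {w \<in> Y. S w \<in> Y}\<close> outside \<open>Y\<^sub>1 = span (Y \<union> {S y\<^sub>1, \<dots>, S y\<^sub>m})\<close>, then for small
  \<open>t \<noteq> 0\<close> the operator \<open>S + t T\<close> would still belong to the open part and would have rank at least
  \<open>m + 1\<close>, witnessed by \<open>y\<^sub>1, \<dots>, y\<^sub>m, w\<close>. So every \<open>T \<in> \<A>\<close> maps \<open>Y\<^sub>0\<close>, which has finite
  codimension in \<open>Y\<close>, into \<open>Y\<^sub>1\<close>, which is a finite-dimensional extension of \<open>Y\<close>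
  (\<open>ex_uniform_almost_invariance\<close>).

  Now let \<open>Z\<close> be the closed span of \<open>Y\<^sub>0\<close> and all images \<open>T Y\<^sub>0\<close> with \<open>T \<in> \<A>\<close>. It is invariant because
  \<open>\<A>\<close> is closed under composition. As \<open>Y\<^sub>1\<close> is closed, \<open>Y\<^sub>0 \<subseteq> Z \<subseteq> Y\<^sub>1\<close>, and so
  \<open>Z\<close> differs from \<open>Y\<close> only by finite dimensions and is again a halfspace.
\<close>

section \<open>Closed subspaces and finitely many additional vectors\<close>

text \<open>
  Completeness of the scalars makes a line closed, and more generally keeps a subspace closed when a
  vector is adjoined; the real and the complex case are treated together.
\<close>

locale complete_scalar_banach_space = banach_space scale
  for scale :: "'k::{real_normed_field,complete_space} \<Rightarrow> 'x::banach \<Rightarrow> 'x"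
begin

text \<open>The constant is the distance from \<open>x\<close> to \<open>Y\<close>, which is positive because \<open>Y\<close> is closed.\<close>

lemma norm_le_norm_scale_add:
  assumes "vs.subspace Y" "closed Y" "x \<notin> Y"
  obtains d where "d > 0" "\<And>c y. y \<in> Y \<Longrightarrow> d * norm c \<le> norm (scale c x + y)"
proof
  have ne: "Y \<noteq> {}"
    using vs.subspace_0[OF assms(1)] by blast
  show "infdist x Y > 0"
    using in_closed_iff_infdist_zero[OF assms(2) ne, of x] assms(3) infdist_nonneg[of x Y]
    by linarith
  show "infdist x Y * norm c \<le> norm (scale c x + y)" if "y \<in> Y" for c y
  proof (cases "c = 0")
    case False
    have "scale c (x - scale (- inverse c) y) = scale c x + y"
      using False by (simp add: vs.scale_right_distrib)
    then have "norm (scale c x + y) = norm c * dist x (scale (- inverse c) y)"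
      by (metis norm_scale dist_norm)
    moreover have "infdist x Y \<le> dist x (scale (- inverse c) y)"
      by (intro infdist_le vs.subspace_scale assms that)
    ultimately show ?thesis
      by (simp add: mult.commute mult_left_mono)
  qed simp
qed

text \<open>
  The coefficient of \<open>x\<close> is a continuous function of the vector, by the preceding bound. Along a
  convergent sequence in the span the coefficients are therefore Cauchy, and the components in \<open>Y\<close>
  converge as well.
\<close>

lemma closed_span_insert:
  assumes Y: "vs.subspace Y" "closed Y"
  shows "closed (vs.span (insert x Y))"
proof (cases "x \<in> Y")
  case True
  then show ?thesis
    using Y by (simp add: insert_absorb vs.span_eq_iff[THEN iffD2])
next
  case False
  obtain d where d: "d > 0" "\<And>c y. y \<in> Y \<Longrightarrow> d * norm c \<le> norm (scale c x + y)"
    using norm_le_norm_scale_add[OF Y False] by blast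
  have span_Y: "vs.span Y = Y"
    using Y(1) by (simp add: vs.span_eq_iff)
  show ?thesis
    unfolding closed_sequential_limits
  proof (intro allI impI, elim conjE)
    fix f l assume f: "\<forall>n. f n \<in> vs.span (insert x Y)" and l: "f \<longlonglongrightarrow> l"
    from f obtain c where c: "\<And>n. f n - scale (c n) x \<in> Y"
      unfolding vs.span_insert span_Y by (simp add: choice_iff) blast
    have "Cauchy c"
    proof (rule metric_CauchyI)
      fix e :: real assume "e > 0"
      then obtain N where N: "\<And>m n. m \<ge> N \<Longrightarrow> n \<ge> N \<Longrightarrow> dist (f m) (f n) < d * e"
        using metric_CauchyD[OF LIMSEQ_imp_Cauchy[OF l], of "d * e"] d(1)
        by (metis mult_pos_pos)
      have "dist (c m) (c n) < e" if "m \<ge> N" "n \<ge> N" for m n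
      proof -
        have "(f m - scale (c m) x) - (f n - scale (c n) x) \<in> Y"
          by (intro vs.subspace_diff Y c)
        then have "d * norm (c m - c n) \<le> norm (f m - f n)"
          using d(2)[of "(f m - scale (c m) x) - (f n - scale (c n) x)" "c m - c n"]
          by (simp add: vs.scale_left_diff_distrib)
        then have "d * dist (c m) (c n) < d * e"
          using N[OF that] by (simp add: dist_norm)
        then show ?thesis using d(1) by simp
      qed
      then show "\<exists>N. \<forall>m\<ge>N. \<forall>n\<ge>N. dist (c m) (c n) < e" by blast
    qed
    then obtain c0 where c0: "c \<longlonglongrightarrow> c0"
      using Cauchy_convergent convergent_def by blast
    have "(\<lambda>n. scale (c n) x) \<longlonglongrightarrow> scale c0 x"
    proof (rule LIM_zero_cancel, rule tendsto_norm_zero_cancel)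
      have "(\<lambda>n. norm (c n - c0) * norm x) \<longlonglongrightarrow> 0"
        using tendsto_mult_left_zero[OF tendsto_norm_zero[OF LIM_zero[OF c0]]] .
      then show "(\<lambda>n. norm (scale (c n) x - scale c0 x)) \<longlonglongrightarrow> 0"
        by (simp add: norm_scale flip: vs.scale_left_diff_distrib)
    qed
    then have "(\<lambda>n. f n - scale (c n) x) \<longlonglongrightarrow> l - scale c0 x"
      by (intro tendsto_diff l)
    then have "l - scale c0 x \<in> Y"
      by (rule closed_sequentially[OF Y(2) c])
    then show "l \<in> vs.span (insert x Y)"
      unfolding vs.span_insert span_Y by blast
  qed
qed

lemma closed_span_Un_finite:
  assumes "vs.subspace Y" "closed Y" "finite B"
  shows "closed (vs.span (Y \<union> B))"
  using assms(3)
proof induction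
  case empty
  then show ?case using assms by (simp add: vs.span_eq_iff[THEN iffD2])
next
  case (insert b B)
  have "vs.span (Y \<union> insert b B) = vs.span (insert b (vs.span (Y \<union> B)))"
    by (simp add: vs.span_insert vs.span_span)
  then show ?case
    using closed_span_insert[OF vs.subspace_span insert.IH] by simp
qed

lemma subspace_closure:
  assumes S: "vs.subspace S"
  shows "vs.subspace (closure S)"
proof (rule vs.subspaceI)
  show "0 \<in> closure S"
    using vs.subspace_0[OF S] closure_subset by blast
next
  fix x y assume "x \<in> closure S" "y \<in> closure S"
  then obtain f g where "\<forall>n. f n \<in> S" "f \<longlonglongrightarrow> x" "\<forall>n. g n \<in> S" "g \<longlonglongrightarrow> y"
    unfolding closure_sequential by blast
  then show "x + y \<in> closure S"
    unfolding closure_sequential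
    by (intro exI[of _ "\<lambda>n. f n + g n"]) (auto intro: tendsto_add vs.subspace_add[OF S])
next
  fix c x assume "x \<in> closure S"
  then obtain f where "\<forall>n. f n \<in> S" "f \<longlonglongrightarrow> x"
    unfolding closure_sequential by blast
  then show "scale c x \<in> closure S"
    unfolding closure_sequential
    by (intro exI[of _ "\<lambda>n. scale c (f n)"])
      (auto intro: bounded_linear.tendsto[OF bounded_linear_scale] vs.subspace_scale[OF S])
qed

lemma finite_dimensional_subset:
  assumes "vs.subspace S" "finite B" "S \<subseteq> vs.span B"
  shows "finite_dimensional S"
proof -
  obtain C where C: "C \<subseteq> S" "vs.independent C" "S \<subseteq> vs.span C"
    using vs.maximal_independent_subset by blast
  have "finite C"
    using vs.independent_span_bound[OF assms(2) C(2)] C(1) assms(3) by blast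
  moreover have "S = vs.span C"
    using C vs.span_minimal[OF C(1) assms(1)] by blast
  ultimately show ?thesis
    unfolding finite_dimensional_def by blast
qed

section \<open>Linear independence modulo a closed subspace\<close>

text \<open>
  Independence of the cosets of \<open>v 0, \<dots>, v (n - 1)\<close> in the quotient by \<open>Y\<close>. The vectors are indexed
  by numbers, as in a perturbation each vector must keep its coefficient.
\<close>

definition independent_mod :: "'x set \<Rightarrow> nat \<Rightarrow> (nat \<Rightarrow> 'x) \<Rightarrow> bool"
  where "independent_mod Y n v \<longleftrightarrow>
    (\<forall>c. (\<Sum>i<n. scale (c i) (v i)) \<in> Y \<longrightarrow> (\<forall>i<n. c i = 0))"

text \<open>
  On the span of finitely many independent cosets, the quotient norm dominates a multiple of the sum
  norm of the coefficients. In the induction the last vector is moved into the subspace: the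
  hypothesis for \<open>Y' = span (insert (v n) Y)\<close> bounds the first \<open>n\<close> coefficients, and
  \<open>norm_le_norm_scale_add\<close> then bounds the last one.
\<close>

lemma independent_mod_bounded_below:
  assumes "vs.subspace Y" "closed Y" "independent_mod Y n v"
  shows "\<exists>d>0. \<forall>c. \<forall>y\<in>Y. d * (\<Sum>i<n. norm (c i)) \<le> norm ((\<Sum>i<n. scale (c i) (v i)) + y)"
  using assms
proof (induction n arbitrary: Y)
  case 0
  then show ?case by (auto intro: exI[of _ 1])
next
  case (Suc n)
  note Y = Suc.prems(1,2) and ind = Suc.prems(3)
  define Y' where "Y' = vs.span (insert (v n) Y)"
  have Y': "x \<in> Y' \<longleftrightarrow> (\<exists>k. x - scale k (v n) \<in> Y)" for x
    using Y(1) by (simp add: Y'_def vs.span_insert vs.span_eq_iff[THEN iffD2])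
  have "v n \<notin> Y"
    using ind[unfolded independent_mod_def, rule_format, of "\<lambda>i. if i = n then 1 else 0" n]
    by (auto simp: if_distrib[of "\<lambda>c. scale c _"] cong: if_cong)
  then obtain d where d: "d > 0" "\<And>c y. y \<in> Y \<Longrightarrow> d * norm c \<le> norm (scale c (v n) + y)"
    using norm_le_norm_scale_add[OF Y] by blast
  have "independent_mod Y' n v"
    unfolding independent_mod_def
  proof (intro allI impI)
    fix c i assume "(\<Sum>i<n. scale (c i) (v i)) \<in> Y'" and i: "i < n"
    then obtain k where "(\<Sum>i<n. scale (c i) (v i)) - scale k (v n) \<in> Y"
      using Y' by blast
    moreover have "(\<Sum>i<n. scale ((c(n := - k)) i) (v i)) = (\<Sum>i<n. scale (c i) (v i))"
      by (rule sum.cong) auto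
    ultimately have "(\<Sum>i<Suc n. scale ((c(n := - k)) i) (v i)) \<in> Y"
      by (simp only: sum.lessThan_Suc fun_upd_same vs.scale_minus_left add_uminus_conv_diff)
    then have "(c(n := - k)) i = 0"
      using ind i less_SucI unfolding independent_mod_def by metis
    then show "c i = 0" using i by simp
  qed
  then obtain d' where d': "d' > 0"
    "\<And>c y. y \<in> Y' \<Longrightarrow> d' * (\<Sum>i<n. norm (c i)) \<le> norm ((\<Sum>i<n. scale (c i) (v i)) + y)"
    using Suc.IH[of Y'] closed_span_insert[OF Y] vs.subspace_span
    unfolding Y'_def by blast
  define M where "M = (\<Sum>i<n. norm (v i))"
  have M: "M \<ge> 0" by (simp add: M_def sum_nonneg)
  \<comment> \<open>With \<open>t\<close> the norm of the combination, the first \<open>n\<close> coefficients contribute at most \<open>t / d'\<close>, and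
      the last one at most \<open>(t + M t / d') / d\<close>.\<close>
  define K where "K = 1 / d' + (1 + M / d') / d"
  have K: "K > 0" using d(1) d'(1) M by (simp add: K_def add_pos_nonneg)
  have "(\<Sum>i<Suc n. norm (c i)) \<le> K * norm ((\<Sum>i<Suc n. scale (c i) (v i)) + y)"
    if y: "y \<in> Y" for c y
  proof -
    define s where "s = (\<Sum>i<n. scale (c i) (v i))"
    define t where "t = norm (s + scale (c n) (v n) + y)"
    define a where "a = (\<Sum>i<n. norm (c i))"
    have "scale (c n) (v n) + y \<in> Y'"
      using Y' y by (metis add_diff_cancel_left')
    then have "d' * a \<le> t"
      using d'(2)[of "scale (c n) (v n) + y" c] by (simp add: s_def t_def a_def add.assoc)
    then have a: "a \<le> t / d'"
      using d'(1) by (simp add: pos_le_divide_eq mult.commute)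
    have "norm s \<le> (\<Sum>i<n. norm (c i) * norm (v i))"
      unfolding s_def by (rule order_trans[OF norm_sum]) (simp add: norm_scale)
    also have "\<dots> \<le> (\<Sum>i<n. norm (c i) * M)"
      unfolding M_def by (intro sum_mono mult_left_mono member_le_sum) auto
    also have "\<dots> = a * M"
      by (simp add: a_def sum_distrib_right)
    finally have s: "norm s \<le> a * M" .
    have "d * norm (c n) \<le> norm (scale (c n) (v n) + y)"
      by (rule d(2)[OF y])
    also have "\<dots> = norm ((s + scale (c n) (v n) + y) - s)"
      by (simp add: algebra_simps)
    also have "\<dots> \<le> t + norm s"
      unfolding t_def by (rule norm_triangle_ineq4)
    also have "\<dots> \<le> t + t / d' * M"
      using s mult_right_mono[OF a M] by linarith
    finally have "norm (c n) \<le> (t + t / d' * M) / d"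
      using d(1) by (simp add: pos_le_divide_eq mult.commute)
    then have "a + norm (c n) \<le> t / d' + (t + t / d' * M) / d"
      using a by linarith
    also have "\<dots> = K * t"
      by (simp add: K_def algebra_simps add_divide_distrib)
    finally show ?thesis
      by (simp add: a_def s_def t_def)
  qed
  then have "1 / K * (\<Sum>i<Suc n. norm (c i)) \<le> norm ((\<Sum>i<Suc n. scale (c i) (v i)) + y)"
    if "y \<in> Y" for c y
    using K that by (simp add: pos_divide_le_eq mult.commute)
  then show ?case
    using K by (intro exI[of _ "1 / K"]) auto
qed

text \<open>
  A combination of the \<open>w i\<close> that lies in \<open>Y\<close> would give a combination of the \<open>v i\<close> close to
  \<open>Y\<close>, relative to the size of its coefficients, against the lower bound.
\<close>

lemma independent_mod_open:
  assumes Y: "vs.subspace Y" "closed Y" and ind: "independent_mod Y n v"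
  obtains \<delta> where "\<delta> > 0" "\<And>w. (\<And>i. i < n \<Longrightarrow> norm (w i - v i) < \<delta>) \<Longrightarrow> independent_mod Y n w"
proof -
  obtain d where d: "d > 0"
    "\<And>c y. y \<in> Y \<Longrightarrow> d * (\<Sum>i<n. norm (c i)) \<le> norm ((\<Sum>i<n. scale (c i) (v i)) + y)"
    using independent_mod_bounded_below[OF assms] by blast
  have "independent_mod Y n w" if w: "\<And>i. i < n \<Longrightarrow> norm (w i - v i) < d / 2" for w
    unfolding independent_mod_def
  proof (intro allI impI)
    fix c i assume y: "(\<Sum>i<n. scale (c i) (w i)) \<in> Y" and i: "i < n"
    let ?y = "\<Sum>i<n. scale (c i) (w i)"
    have "d * (\<Sum>i<n. norm (c i)) \<le> norm ((\<Sum>i<n. scale (c i) (v i)) + - ?y)"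
      using d(2) vs.subspace_neg[OF Y(1) y] by blast
    also have "(\<Sum>i<n. scale (c i) (v i)) + - ?y = (\<Sum>i<n. scale (c i) (v i - w i))"
      by (simp add: vs.scale_right_diff_distrib sum_subtractf)
    also have "norm \<dots> \<le> (\<Sum>i<n. norm (c i) * (d / 2))"
    proof (rule order_trans[OF norm_sum], rule sum_mono)
      fix i assume "i \<in> {..<n}"
      then have "norm (v i - w i) \<le> d / 2"
        using w[of i] by (simp add: norm_minus_commute)
      then show "norm (scale (c i) (v i - w i)) \<le> norm (c i) * (d / 2)"
        unfolding norm_scale by (rule mult_left_mono) simp
    qed
    also have "\<dots> = d / 2 * (\<Sum>i<n. norm (c i))"
      unfolding sum_distrib_right[symmetric] by (rule mult.commute)
    finally have "(\<Sum>i<n. norm (c i)) \<le> 0"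
      using d(1) by (simp add: field_simps)
    then have "(\<Sum>i<n. norm (c i)) = 0"
      by (simp add: sum_nonneg order_antisym)
    then show "c i = 0"
      using i by (simp add: sum_nonneg_eq_0_iff)
  qed
  then show ?thesis
    using that[of "d / 2"] d(1) by simp
qed

lemma independent_mod_Suc:
  assumes Y: "vs.subspace Y" and ind: "independent_mod Y n v"
    and x: "x \<notin> vs.span (Y \<union> v ` {..<n})"
  shows "independent_mod Y (Suc n) (v(n := x))"
  unfolding independent_mod_def
proof (rule allI, rule impI)
  fix c assume "(\<Sum>i<Suc n. scale (c i) ((v(n := x)) i)) \<in> Y"
  then have y: "(\<Sum>i<n. scale (c i) (v i)) + scale (c n) x \<in> Y"
    by simp
  let ?S = "vs.span (Y \<union> v ` {..<n})"
  have "(\<Sum>i<n. scale (c i) (v i)) \<in> ?S"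
    by (intro vs.span_sum vs.span_scale vs.span_base) auto
  then have S: "scale (c n) x \<in> ?S"
    using y vs.span_diff[of _ _ _] vs.span_base[of _ "Y \<union> v ` {..<n}"]
    by (metis UnI1 add_diff_cancel_left')
  have "c n = 0"
  proof (rule ccontr)
    assume "c n \<noteq> 0"
    then have "x = scale (inverse (c n)) (scale (c n) x)" by simp
    then show False using vs.span_scale[OF S] x by metis
  qed
  moreover from this have "\<forall>i<n. c i = 0"
    using y ind by (simp add: independent_mod_def)
  ultimately show "\<forall>i<Suc n. c i = 0"
    by (simp add: less_Suc_eq)
qed

text \<open>
  Modulo \<open>Y\<close> the vectors agree with elements of \<open>span B\<close>, and these inherit the independence.
\<close>

lemma independent_mod_span_bound:
  assumes Y: "vs.subspace Y" and B: "finite B"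
    and v: "\<And>i. i < n \<Longrightarrow> \<exists>y\<in>Y. \<exists>e\<in>vs.span B. v i = y + e"
    and ind: "independent_mod Y n v"
  shows "n \<le> card B"
proof -
  obtain e where e: "\<And>i. i < n \<Longrightarrow> e i \<in> vs.span B \<and> v i - e i \<in> Y"
    using v by (metis add_diff_cancel_right')
  have zero: "\<forall>i<n. c i = 0" if c: "(\<Sum>i<n. scale (c i) (e i)) = 0" for c
  proof -
    have "(\<Sum>i<n. scale (c i) (v i - e i)) \<in> Y"
      using e by (intro vs.subspace_sum vs.subspace_scale Y) auto
    then show ?thesis
      using c ind by (simp add: independent_mod_def vs.scale_right_diff_distrib sum_subtractf)
  qed
  have inj: "inj_on e {..<n}"
  proof (rule inj_onI, rule ccontr)
    fix i j assume ij: "i \<in> {..<n}" "j \<in> {..<n}" "e i = e j" "i \<noteq> j"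
    let ?c = "\<lambda>k. (if k = i then 1 else 0) - (if k = j then 1 else (0::'k))"
    have "(\<Sum>k<n. scale (?c k) (e k)) = 0"
      using ij by (simp add: vs.scale_left_diff_distrib sum_subtractf
          if_distrib[of "\<lambda>c. scale c _"] cong: if_cong)
    from zero[OF this] ij show False by force
  qed
  have "vs.independent (e ` {..<n})"
  proof
    assume "vs.dependent (e ` {..<n})"
    then obtain u where u: "\<exists>v\<in>e ` {..<n}. u v \<noteq> 0" "(\<Sum>v\<in>e ` {..<n}. scale (u v) v) = 0"
      using vs.dependent_finite[of "e ` {..<n}"] by auto
    have "(\<Sum>i<n. scale (u (e i)) (e i)) = 0"
      using u(2) by (simp add: sum.reindex[OF inj])
    from zero[OF this] u(1) show False by auto
  qed
  then have "card (e ` {..<n}) \<le> card B"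
    using vs.independent_span_bound[OF B] e by blast
  then show ?thesis
    by (simp add: card_image[OF inj])
qed

section \<open>The rank of an operator from a subspace to the quotient by it\<close>

text \<open>
  For linear \<open>T\<close>, membership says that the operator \<open>Y \<rightarrow> X / Y\<close> induced by \<open>T\<close> has rank at least \<open>n\<close>.
  Phrasing this through witnesses makes openness visible and does not require the quotient
  space.
\<close>

definition rank_ge :: "'x set \<Rightarrow> nat \<Rightarrow> ('x \<Rightarrow>\<^sub>L 'x) set"
  where "rank_ge Y n = {T :: 'x \<Rightarrow>\<^sub>L 'x. \<exists>y. (\<forall>i<n. y i \<in> Y) \<and> independent_mod Y n (\<lambda>i. T (y i))}"

lemma open_rank_ge:
  assumes Y: "vs.subspace Y" "closed Y"
  shows "open (rank_ge Y n)"
  unfolding open_dist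
proof
  fix T assume "T \<in> rank_ge Y n"
  then obtain y where y: "\<forall>i<n. y i \<in> Y" "independent_mod Y n (\<lambda>i. T (y i))"
    by (auto simp: rank_ge_def)
  obtain \<delta> where \<delta>: "\<delta> > 0"
    "\<And>w. (\<And>i. i < n \<Longrightarrow> norm (w i - T (y i)) < \<delta>) \<Longrightarrow> independent_mod Y n w"
    using independent_mod_open[OF Y y(2)] by blast
  define M where "M = 1 + (\<Sum>i<n. norm (y i))"
  have M: "M > 0" by (simp add: M_def sum_nonneg add_pos_nonneg)
  have "S \<in> rank_ge Y n" if S: "dist S T < \<delta> / M" for S
  proof -
    have "norm (S (y i) - T (y i)) < \<delta>" if i: "i < n" for i
    proof -
      have "norm (y i) \<le> (\<Sum>i<n. norm (y i))"
        using i by (intro member_le_sum) auto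
      then have "norm (y i) \<le> M" by (simp add: M_def)
      have "norm (S (y i) - T (y i)) \<le> norm (S - T) * norm (y i)"
        by (metis minus_blinfun.rep_eq norm_blinfun)
      also have "\<dots> \<le> norm (S - T) * M"
        by (intro mult_left_mono \<open>norm (y i) \<le> M\<close>) simp
      also have "\<dots> < \<delta>"
        using S M by (simp add: dist_norm pos_less_divide_eq)
      finally show ?thesis .
    qed
    then show ?thesis
      using \<delta>(2)[of "\<lambda>i. S (y i)"] y(1) by (auto simp: rank_ge_def)
  qed
  then show "\<exists>e>0. \<forall>S. dist S T < e \<longrightarrow> S \<in> rank_ge Y n"
    using \<delta>(1) M by (intro exI[of _ "\<delta> / M"]) auto
qed

lemma almost_invariant_rank_bounded:
  assumes "vs.subspace Y" "almost_invariant T Y"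
  shows "\<exists>n. T \<notin> rank_ge Y n"
proof -
  obtain B where B: "finite B" "blinfun_apply T ` Y \<subseteq> {y + e | y e. y \<in> Y \<and> e \<in> vs.span B}"
    using assms(2) unfolding almost_invariant_def finite_dimensional_def by blast
  have "T \<notin> rank_ge Y (Suc (card B))"
  proof
    assume "T \<in> rank_ge Y (Suc (card B))"
    then obtain y where y: "\<forall>i<Suc (card B). y i \<in> Y"
      "independent_mod Y (Suc (card B)) (\<lambda>i. T (y i))"
      by (auto simp: rank_ge_def)
    have "Suc (card B) \<le> card B"
      by (rule independent_mod_span_bound[OF assms(1) B(1) _ y(2)]) (use y(1) B(2) in blast)
    then show False by simp
  qed
  then show ?thesis ..
qed

text \<open>
  If every \<open>\<A> \<inter> rank_ge Y n\<close> were dense in \<open>\<A>\<close>, then by Baire so would be their intersection, which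
  is empty: almost-invariance under \<open>T\<close> bounds the rank of \<open>T\<close>.
\<close>

lemma almost_invariant_locally_bounded_rank:
  assumes Y: "vs.subspace Y" "closed Y" and \<A>: "closed \<A>" "\<A> \<noteq> {}"
    and inv: "\<forall>T\<in>\<A>. almost_invariant T Y"
  obtains V n where "open V" "\<A> \<inter> V \<noteq> {}" "\<A> \<inter> V \<inter> rank_ge Y n = {}"
proof -
  have "\<exists>n. (top_of_set \<A>) closure_of (\<A> \<inter> rank_ge Y n) \<noteq> \<A>"
  proof (rule ccontr)
    assume "\<not> ?thesis"
    then have "(top_of_set \<A>) closure_of (\<Inter>n. \<A> \<inter> rank_ge Y n) = topspace (top_of_set \<A>)"
      using \<A>(1) open_rank_ge[OF Y]
      by (intro Baire_category disjI1 completely_metrizable_space_closedin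
          completely_metrizable_space_euclidean)
        (auto simp: openin_open_Int)
    moreover have "(\<Inter>n. \<A> \<inter> rank_ge Y n) = {}"
      using almost_invariant_rank_bounded[OF Y(1)] inv by blast
    ultimately show False using \<A>(2) by simp
  qed
  then obtain n T where T: "T \<in> \<A>" "T \<notin> (top_of_set \<A>) closure_of (\<A> \<inter> rank_ge Y n)"
    using closure_of_subset_topspace[of "top_of_set \<A>"] by fastforce
  then obtain U where "T \<in> U" "openin (top_of_set \<A>) U" "\<A> \<inter> rank_ge Y n \<inter> U = {}"
    by (auto simp: in_closure_of)
  moreover then obtain V where "open V" "U = \<A> \<inter> V"
    by (auto simp: openin_open)
  ultimately show ?thesis
    using T(1) by (intro that[of V n]) auto
qed

section \<open>Operators of locally maximal rank\<close>

text \<open>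
  Where the rank is exactly \<open>m\<close>, the images of \<open>m\<close> witnesses span the whole induced range.
\<close>

lemma rank_witnesses_span_range:
  fixes S :: "'x \<Rightarrow>\<^sub>L 'x"
  assumes Y: "vs.subspace Y" and y: "\<forall>i<m. y i \<in> Y"
    and ind: "independent_mod Y m (\<lambda>i. S (y i))"
    and S: "S \<notin> rank_ge Y (Suc m)" and w: "w \<in> Y"
  shows "S w \<in> vs.span (Y \<union> (\<lambda>i. S (y i)) ` {..<m})"
proof (rule ccontr)
  assume "\<not> ?thesis"
  from independent_mod_Suc[OF Y ind this]
  have "independent_mod Y (Suc m) (\<lambda>i. S ((y(m := w)) i))"
    by (rule back_subst[of "independent_mod Y (Suc m)"]) auto
  moreover have "\<forall>i<Suc m. (y(m := w)) i \<in> Y"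
    using y w by auto
  ultimately show False
    using S unfolding rank_ge_def by blast
qed

text \<open>
  The perturbation argument. Apply \<open>P t = S + t T\<close> to \<open>y 0, \<dots>, y (m - 1), w\<close>. The first \<open>m\<close> images are
  close to those under \<open>S\<close>, while modulo \<open>Y\<close> the last one is \<open>t T w\<close>, since \<open>S w \<in> Y\<close>. If \<open>T w\<close> were
  outside the span, these images would be independent modulo \<open>Y\<close> for small \<open>t \<noteq> 0\<close>.
\<close>

lemma locally_maximal_rank_maps_kernel:
  assumes Y: "vs.subspace Y" "closed Y" and \<A>: "op.subspace \<A>" and V: "open V"
    and S: "S \<in> \<A> \<inter> V" and T: "T \<in> \<A>"
    and y: "\<forall>i<m. y i \<in> Y" and ind: "independent_mod Y m (\<lambda>i. S (y i))"
    and max: "\<A> \<inter> V \<inter> rank_ge Y (Suc m) = {}"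
    and w: "w \<in> Y" "S w \<in> Y"
  shows "T w \<in> vs.span (Y \<union> (\<lambda>i. S (y i)) ` {..<m})"
proof (rule ccontr)
  assume "\<not> ?thesis"
  define v where "v = (\<lambda>i. S (y i))(m := T w)"
  have "independent_mod Y (Suc m) v"
    unfolding v_def by (rule independent_mod_Suc[OF Y(1) ind]) fact
  then obtain \<delta> where \<delta>: "\<delta> > 0"
    "\<And>u. (\<And>i. i < Suc m \<Longrightarrow> norm (u i - v i) < \<delta>) \<Longrightarrow> independent_mod Y (Suc m) u"
    using independent_mod_open[OF Y] by metis
  define P where "P t = S + t *\<^sub>R T" for t :: real
  have P_0: "P 0 = S"
    by (simp add: P_def)
  have cont: "isCont P 0"
    unfolding P_def by (intro continuous_intros)
  have "\<forall>\<^sub>F t in at 0. P t \<in> V"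
    using topological_tendstoD[OF cont[unfolded isCont_def] V] S by (simp add: P_0)
  moreover have "\<forall>\<^sub>F t in at 0. \<forall>i\<in>{..<m}. norm (P t (y i) - S (y i)) < \<delta>"
  proof (rule eventually_ball_finite)
    show "\<forall>i\<in>{..<m}. \<forall>\<^sub>F t in at 0. norm (P t (y i) - S (y i)) < \<delta>"
    proof
      fix i
      have "((\<lambda>t. P t (y i)) \<longlongrightarrow> P 0 (y i)) (at 0)"
        by (rule blinfun.tendsto[OF cont[unfolded isCont_def] tendsto_const])
      from tendstoD[OF this \<delta>(1)] show "\<forall>\<^sub>F t in at 0. norm (P t (y i) - S (y i)) < \<delta>"
        by (simp add: P_0 dist_norm)
    qed
  qed simp
  moreover have "\<forall>\<^sub>F t in at (0::real). t \<noteq> 0"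
    by (simp add: eventually_at_filter)
  ultimately have "\<forall>\<^sub>F t in at 0. P t \<in> V \<and> (\<forall>i\<in>{..<m}. norm (P t (y i) - S (y i)) < \<delta>) \<and> t \<noteq> 0"
    by eventually_elim auto
  from eventually_happens'[OF at_neq_bot this]
  obtain t where t: "P t \<in> V" "\<And>i. i < m \<Longrightarrow> norm (P t (y i) - S (y i)) < \<delta>" "t \<noteq> 0"
    by auto
  \<comment> \<open>The last vector is kept equal to \<open>T w\<close>; only the first \<open>m\<close> are perturbed. Rescaling the last
      coefficient by \<open>t\<close> then turns \<open>T w\<close> into \<open>t T w\<close>.\<close>
  have ind': "independent_mod Y (Suc m) ((\<lambda>i. P t (y i))(m := T w))"
  proof (rule \<delta>(2))
    fix i assume "i < Suc m"
    then show "norm (((\<lambda>i. P t (y i))(m := T w)) i - v i) < \<delta>"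
      using t(2)[of i] \<delta>(1) by (cases "i = m") (simp_all add: v_def)
  qed
  have "independent_mod Y (Suc m) (\<lambda>i. P t ((y(m := w)) i))"
    unfolding independent_mod_def
  proof (rule allI, rule impI)
    fix c assume c: "(\<Sum>i<Suc m. scale (c i) (P t ((y(m := w)) i))) \<in> Y"
    have "(\<Sum>i<m. scale (c i) (P t ((y(m := w)) i))) = (\<Sum>i<m. scale (c i) (P t (y i)))"
      by (rule sum.cong) auto
    with c have "(\<Sum>i<m. scale (c i) (P t (y i))) + scale (c m) (S w + t *\<^sub>R T w) \<in> Y"
      by (simp add: P_def blinfun.add_left blinfun.scaleR_left)
    from vs.subspace_diff[OF Y(1) this vs.subspace_scale[OF Y(1) w(2)], of "c m"]
    have "(\<Sum>i<m. scale (c i) (P t (y i))) + scale (c m * of_real t) (T w) \<in> Y"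
      by (simp add: vs.scale_right_distrib flip: scale_of_real)
    moreover have "(\<Sum>i<m. scale ((c(m := c m * of_real t)) i)
        (((\<lambda>i. P t (y i))(m := T w)) i)) = (\<Sum>i<m. scale (c i) (P t (y i)))"
      by (rule sum.cong) auto
    ultimately have "(\<Sum>i<Suc m. scale ((c(m := c m * of_real t)) i)
        (((\<lambda>i. P t (y i))(m := T w)) i)) \<in> Y"
      by (simp only: sum.lessThan_Suc fun_upd_same)
    from ind'[unfolded independent_mod_def, rule_format, OF this]
    have *: "(c(m := c m * of_real t)) i = 0" if "i < Suc m" for i
      using that by blast
    show "\<forall>i<Suc m. c i = 0"
      using *[of m] * t(3) by (metis fun_upd_apply lessI mult_eq_0_iff of_real_eq_0_iff)
  qed
  moreover have "\<forall>i<Suc m. (y(m := w)) i \<in> Y"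
    using y w(1) by auto
  ultimately have "P t \<in> rank_ge Y (Suc m)"
    unfolding rank_ge_def by blast
  moreover have "P t \<in> \<A>"
  proof -
    have "op_scale (of_real t) T = t *\<^sub>R T"
      by (rule blinfun_eqI) (simp add: scale_of_real blinfun.scaleR_left)
    then show ?thesis
      unfolding P_def using op.subspace_add[OF \<A>] op.subspace_scale[OF \<A> T] S
      by (metis IntD1)
  qed
  ultimately show False
    using t(1) max by blast
qed

section \<open>The invariant halfspace\<close>

text \<open>
  The subspaces are \<open>Y0 = {w \<in> Y. S w \<in> Y}\<close> for an \<open>S\<close> of locally maximal rank, \<open>E\<close> the witnesses of
  that rank and \<open>F\<close> their images under \<open>S\<close>. That \<open>Y0\<close> and \<open>E\<close> span \<open>Y\<close> is the rank-nullity argument: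
  modulo \<open>Y\<close>, each \<open>S w\<close> is a combination of the vectors in \<open>F\<close>.
\<close>

lemma ex_uniform_almost_invariance:
  assumes Y: "vs.subspace Y" "closed Y"
    and \<A>: "\<A> \<subseteq> operators" "op.subspace \<A>" "closed \<A>"
    and inv: "\<forall>T\<in>\<A>. almost_invariant T Y"
  obtains Y0 E F where "vs.subspace Y0" "finite E" "finite F" "Y0 \<subseteq> Y" "Y \<subseteq> vs.span (Y0 \<union> E)"
    "\<And>T w. T \<in> \<A> \<Longrightarrow> w \<in> Y0 \<Longrightarrow> T w \<in> vs.span (Y \<union> F)"
proof -
  obtain V n where V: "open V" "\<A> \<inter> V \<noteq> {}" "\<A> \<inter> V \<inter> rank_ge Y n = {}"
    using almost_invariant_locally_bounded_rank[OF Y \<A>(3) _ inv] op.subspace_0[OF \<A>(2)] by blast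
  \<comment> \<open>The maximal rank on \<open>\<A> \<inter> V\<close> is the predecessor of the least rank that does not occur.\<close>
  define k where "k = (LEAST n. \<A> \<inter> V \<inter> rank_ge Y n = {})"
  have k: "\<A> \<inter> V \<inter> rank_ge Y k = {}"
    unfolding k_def using V(3) by (rule LeastI)
  have "rank_ge Y 0 = UNIV"
    by (simp add: rank_ge_def independent_mod_def)
  then obtain m where m: "k = Suc m"
    using k V(2) by (cases k) auto
  have "\<A> \<inter> V \<inter> rank_ge Y m \<noteq> {}"
    using not_less_Least[of m "\<lambda>n. \<A> \<inter> V \<inter> rank_ge Y n = {}"] m by (simp add: k_def)
  then obtain S y where S: "S \<in> \<A> \<inter> V" and y: "\<forall>i<m. y i \<in> Y"
    and ind: "independent_mod Y m (\<lambda>i. S (y i))"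
    by (auto simp: rank_ge_def)
  have lin: "Vector_Spaces.linear scale scale (blinfun_apply S)"
    using S \<A>(1) by (auto simp: operators_def)
  interpret S: Vector_Spaces.linear scale scale "blinfun_apply S" by (rule lin)
  define Y0 where "Y0 = {w \<in> Y. S w \<in> Y}"
  show ?thesis
  proof (rule that)
    show "vs.subspace Y0"
      unfolding Y0_def
      by (rule vs.subspaceI)
        (auto simp: S.add S.scale S.zero intro: vs.subspace_0 vs.subspace_add vs.subspace_scale Y(1))
    show "finite (y ` {..<m})" "finite ((\<lambda>i. S (y i)) ` {..<m})"
      by auto
    show "Y0 \<subseteq> Y" by (auto simp: Y0_def)
    show "T w \<in> vs.span (Y \<union> (\<lambda>i. S (y i)) ` {..<m})" if "T \<in> \<A>" "w \<in> Y0" for T w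
      using locally_maximal_rank_maps_kernel[OF Y \<A>(2) V(1) S that(1) y ind k[unfolded m]] that(2)
      by (auto simp: Y0_def)
    show "Y \<subseteq> vs.span (Y0 \<union> y ` {..<m})"
    proof
      fix w assume w: "w \<in> Y"
      have "S w \<in> vs.span (Y \<union> (\<lambda>i. S (y i)) ` {..<m})"
        using k m S by (intro rank_witnesses_span_range[OF Y(1) y ind _ w]) auto
      also have "\<dots> = {a + b | a b. a \<in> Y \<and> b \<in> vs.span ((\<lambda>i. S (y i)) ` {..<m})}"
        using Y(1) by (simp add: vs.span_Un vs.span_eq_iff[THEN iffD2])
      also have "(\<lambda>i. S (y i)) ` {..<m} = S ` y ` {..<m}"
        by (simp add: image_image)
      also have "vs.span \<dots> = S ` vs.span (y ` {..<m})"
        by (rule S.span_image)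
      finally obtain a z where a: "a \<in> Y" and z: "z \<in> vs.span (y ` {..<m})" and Sw: "S w = a + S z"
        by auto
      have "z \<in> Y"
        using vs.span_minimal[OF _ Y(1), of "y ` {..<m}"] y z by auto
      then have "w - z \<in> Y0"
        using w a Sw vs.subspace_diff[OF Y(1)] by (auto simp: Y0_def S.diff)
      then have "(w - z) + z \<in> vs.span (Y0 \<union> y ` {..<m})"
        using z vs.span_mono[of "y ` {..<m}" "Y0 \<union> y ` {..<m}"]
        by (intro vs.span_add) (auto intro: vs.span_base)
      then show "w \<in> vs.span (Y0 \<union> y ` {..<m})" by simp
    qed
  qed
qed

text \<open>
  \<open>Z\<close> contains \<open>Y0\<close> and lies in the closed subspace \<open>span (Y \<union> F)\<close>, so a finite spanning set for
  \<open>Z\<close>, or for its quotient, would enlarge to one for \<open>Y\<close>. The generators include \<open>Y0\<close> itself because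
  \<open>\<A>\<close> may fail to contain the identity and \<open>Z\<close> could otherwise become too small.
\<close>

theorem ex_invariant_halfspace:
  assumes \<A>: "closed_algebra \<A>" and Y: "halfspace Y"
    and inv: "\<forall>A\<in>\<A>. almost_invariant A Y"
  shows "\<exists>Z. halfspace Z \<and> (\<forall>A\<in>\<A>. blinfun_apply A ` Z \<subseteq> Z)"
proof -
  have Y': "vs.subspace Y" "closed Y" "\<not> finite_dimensional Y" "\<not> finite_codimensional Y"
    using Y unfolding halfspace_def by blast+
  have \<A>': "\<A> \<subseteq> operators" "op.subspace \<A>" "closed \<A>"
    and mult: "\<And>S T. S \<in> \<A> \<Longrightarrow> T \<in> \<A> \<Longrightarrow> S o\<^sub>L T \<in> \<A>"
    using \<A> unfolding closed_algebra_def by blast+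
  obtain Y0 E F where Y0: "vs.subspace Y0" "finite E" "finite F" "Y0 \<subseteq> Y" "Y \<subseteq> vs.span (Y0 \<union> E)"
    and F: "\<And>T w. T \<in> \<A> \<Longrightarrow> w \<in> Y0 \<Longrightarrow> T w \<in> vs.span (Y \<union> F)"
    using ex_uniform_almost_invariance[OF Y'(1,2) \<A>' inv] by blast
  define G where "G = Y0 \<union> (\<Union>T\<in>\<A>. blinfun_apply T ` Y0)"
  define Z where "Z = closure (vs.span G)"
  have Z_sub: "vs.subspace Z"
    unfolding Z_def by (intro subspace_closure vs.subspace_span)
  have Y0_Z: "Y0 \<subseteq> Z"
    unfolding Z_def G_def
    using closure_subset[of "vs.span (Y0 \<union> (\<Union>T\<in>\<A>. blinfun_apply T ` Y0))"] vs.span_superset by blast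
  have "G \<subseteq> vs.span (Y \<union> F)"
    using F Y0(4) by (auto simp: G_def intro: vs.span_base)
  then have Z_Y: "Z \<subseteq> vs.span (Y \<union> F)"
    unfolding Z_def
    by (intro closure_minimal closed_span_Un_finite[OF Y'(1,2) Y0(3)])
      (simp add: vs.span_minimal vs.subspace_span)
  have "\<not> finite_dimensional Z"
  proof
    assume "finite_dimensional Z"
    then obtain B where B: "finite B" "Z = vs.span B"
      by (auto simp: finite_dimensional_def)
    have "Y0 \<union> E \<subseteq> vs.span (B \<union> E)"
      using Y0_Z vs.span_mono[of B "B \<union> E"] B(2) by (auto intro: vs.span_base)
    then have "vs.span (Y0 \<union> E) \<subseteq> vs.span (B \<union> E)"
      by (simp add: vs.span_minimal vs.subspace_span)
    then have "finite_dimensional Y"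
      using finite_dimensional_subset[OF Y'(1), of "B \<union> E"] B(1) Y0(2,5) by simp
    then show False using Y'(3) by blast
  qed
  moreover have "\<not> finite_codimensional Z"
  proof
    assume "finite_codimensional Z"
    then obtain B where B: "finite B" "vs.span (Z \<union> B) = UNIV"
      by (auto simp: finite_codimensional_def)
    have "Z \<union> B \<subseteq> vs.span (Y \<union> (F \<union> B))"
      using Z_Y vs.span_mono[of "Y \<union> F" "Y \<union> (F \<union> B)"] by (auto intro: vs.span_base)
    then have "vs.span (Z \<union> B) \<subseteq> vs.span (Y \<union> (F \<union> B))"
      by (simp add: vs.span_minimal vs.subspace_span)
    then have "finite_codimensional Y"
      using B Y0(3) unfolding finite_codimensional_def
      by (intro exI[of _ "F \<union> B"]) auto
    then show False using Y'(4) by blast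
  qed
  moreover have "T ` Z \<subseteq> Z" if T: "T \<in> \<A>" for T
  proof -
    have lin: "Vector_Spaces.linear scale scale (blinfun_apply T)"
      using T \<A>'(1) by (auto simp: operators_def)
    interpret T: Vector_Spaces.linear scale scale "blinfun_apply T" by (rule lin)
    have "S w \<in> T -` G" if "S \<in> \<A>" "w \<in> Y0" for S w
      using mult[OF T that(1)] that(2) by (force simp: G_def)
    then have "T ` G \<subseteq> G"
      using T by (auto simp: G_def)
    then have "T ` vs.span G \<subseteq> vs.span G"
      by (metis T.span_image vs.span_mono)
    moreover have "T ` closure (vs.span G) \<subseteq> closure (T ` vs.span G)"
      by (rule closure_bounded_linear_image_subset[OF blinfun.bounded_linear_right])
    ultimately show ?thesis
      unfolding Z_def using closure_mono by blast
  qed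
  ultimately show ?thesis
    using Z_sub unfolding halfspace_def Z_def by (intro exI[of _ "closure (vs.span G)"]) auto
qed

end

theorem theorem1p1:
  shows
    "(\<forall>\<A> :: ('r::banach \<Rightarrow>\<^sub>L 'r) set.
        banach_space.closed_algebra scaleR \<A> \<longrightarrow>
        (\<exists>Y. banach_space.halfspace scaleR Y \<and>
          (\<forall>A\<in>\<A>. banach_space.almost_invariant scaleR A Y)) \<longrightarrow>
        (\<exists>Z. banach_space.halfspace scaleR Z \<and>
          (\<forall>A\<in>\<A>. blinfun_apply A ` Z \<subseteq> Z)))
     \<and>
     (\<forall>(scaleC :: complex \<Rightarrow> 'c::banach \<Rightarrow> 'c) (\<A> :: ('c \<Rightarrow>\<^sub>L 'c) set).
        banach_space scaleC \<longrightarrow>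
        banach_space.closed_algebra scaleC \<A> \<longrightarrow>
        (\<exists>Y. banach_space.halfspace scaleC Y \<and>
          (\<forall>A\<in>\<A>. banach_space.almost_invariant scaleC A Y)) \<longrightarrow>
        (\<exists>Z. banach_space.halfspace scaleC Z \<and>
          (\<forall>A\<in>\<A>. blinfun_apply A ` Z \<subseteq> Z)))"
proof (intro conjI allI impI)
  fix \<A> :: "('r \<Rightarrow>\<^sub>L 'r) set"
  interpret complete_scalar_banach_space "scaleR :: real \<Rightarrow> 'r \<Rightarrow> 'r"
    by (intro complete_scalar_banach_space.intro banach_space_scaleR)
  assume "closed_algebra \<A>" "\<exists>Y. halfspace Y \<and> (\<forall>A\<in>\<A>. almost_invariant A Y)"
  then show "\<exists>Z. halfspace Z \<and> (\<forall>A\<in>\<A>. blinfun_apply A ` Z \<subseteq> Z)"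
    using ex_invariant_halfspace by blast
next
  fix scaleC :: "complex \<Rightarrow> 'c \<Rightarrow> 'c" and \<A> :: "('c \<Rightarrow>\<^sub>L 'c) set"
  assume "banach_space scaleC"
  then interpret complete_scalar_banach_space scaleC
    by (rule complete_scalar_banach_space.intro)
  assume "closed_algebra \<A>" "\<exists>Y. halfspace Y \<and> (\<forall>A\<in>\<A>. almost_invariant A Y)"
  then show "\<exists>Z. halfspace Z \<and> (\<forall>A\<in>\<A>. blinfun_apply A ` Z \<subseteq> Z)"
    using ex_invariant_halfspace by blast
qed

end
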